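(* Let $\kappa$ be an uncountable regular cardinal with $\kappa\ge\mathfrak{c}^+$, where $\mathfrak{c}=2^{\aleph_0}$, and let $X$ be a real WLD Banach space with $\operatorname{dens}(X)=\kappa$. Suppose that $X$ is isomorphic to a subspace of $\ell^\infty_\omega(\kappa)$, or, equivalently, that there are $C>0$ and a family $\{f_\alpha\}_{\alpha<\kappa}$ in the unit sphere of $X^*$ such that $C\mathbf{B}_{X^*}\subset\overline{\mathrm{conv}}^{w^*}(\{f_\alpha:\alpha<\kappa\})$ and $$|\{\alpha<\kappa: f_\alpha(x)\ne0\}|\le\aleph_0\quad\text{for all }x\in X.$$ Then $X$ has an unconditional basic sequence of length $\omega_1$. If $X$ embeds isometrically into $\ell^\infty_\omega(\kappa)$, then the unconditional sequence can be chosen to be additionally $1$-suppression unconditional.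
   Context: $\ell^\infty_\omega(\kappa)$ is the closed subspace of $\ell^\infty(\kappa)$ consisting of the elements with countable support. $\mathbf{B}_{X^*}$ is the closed unit ball of $X^*$. A Banach space $X$ is WLD (Weakly Lindelöf Determined) iff it admits a Markushevich basis and has Corson's property (C); equivalently, $X$ has a Markushevich basis $\{(x_\alpha,g_\alpha)\}$ such that $\{\alpha:f(x_\alpha)\ne0\}$ is countable for every $f\in X^*$. (Markushevich basis: a biorthogonal system whose vectors have dense linear span in $X$ and whose functionals have $w^*$-dense linear span in $X^*$. Property (C): for any $\Gamma\subset X^*$ and $f\in\overline{\Gamma}^{w^*}$ there is a countable $\Gamma_0\subset\Gamma$ with $f\in\overline{\mathrm{conv}}^{w^*}(\Gamma_0)$.) A normalized sequence $\{e_\alpha\}_{\alpha<\omega_1}$ is $C$-suppression unconditional if $\|\sum_{\alpha\in A}c_\alpha e_\alpha\|\le C\|\sum_{\alpha\in B}c_\alpha e_\alpha\|$ for all finite $A\subset B\subset\omega_1$ and real $c_\alpha$; it is $C$-unconditional if $\|\sum_{\alpha\in A}c_\alpha e_\alpha\|\le C\|\sum_{\alpha\in A}\theta(\alpha)c_\alpha e_\alpha\|$ for all finite $A$, real $c_\alpha$ and signs $\theta(\alpha)\in\{\pm1\}$; unconditional means $C$-unconditional for some $C<\infty$. *)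

theory Defs
  imports "HOL-Analysis.Analysis" "HOL-Probability.Discrete_Topology"
begin

unbundle cardinal_syntax

text \<open>
  Cardinals are the well-order relations satisfying \<^const>\<open>Card_order\<close>; the index set
  \<open>{\<alpha>. \<alpha> < \<kappa>}\<close> is \<open>Field \<kappa>\<close>. The dual of a real Banach space \<open>'a\<close> is \<open>'a \<Rightarrow>\<^sub>L real\<close>.
\<close>

text \<open>For scalar-valued operators, the strong operator topology (pointwise convergence) is the
  weak* topology.\<close>

abbreviation weak_star :: "('a::real_normed_vector \<Rightarrow>\<^sub>L real) topology" where
  "weak_star \<equiv> strong_operator_topology"

definition has_density :: "'a::topological_space itself \<Rightarrow> 'k rel \<Rightarrow> bool" where
  "has_density _ \<kappa> \<longleftrightarrow>
     (\<exists>D::'a set. closure D = UNIV \<and> |D| =o \<kappa>) \<and>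
     (\<forall>D::'a set. closure D = UNIV \<longrightarrow> \<kappa> \<le>o |D| )"

definition markushevich_basis ::
  "'i set \<Rightarrow> ('i \<Rightarrow> 'a::real_normed_vector) \<Rightarrow> ('i \<Rightarrow> 'a \<Rightarrow>\<^sub>L real) \<Rightarrow> bool" where
  "markushevich_basis I x g \<longleftrightarrow>
     (\<forall>\<alpha>\<in>I. \<forall>\<beta>\<in>I. blinfun_apply (g \<alpha>) (x \<beta>) = (if \<alpha> = \<beta> then 1 else 0)) \<and>
     closure (span (x ` I)) = UNIV \<and>
     weak_star closure_of (span (g ` I)) = UNIV"

definition corson_property_C :: "'a::real_normed_vector itself \<Rightarrow> bool" where
  "corson_property_C _ \<longleftrightarrow>
     (\<forall>(\<Gamma>::('a \<Rightarrow>\<^sub>L real) set) f. f \<in> weak_star closure_of \<Gamma> \<longrightarrow>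
        (\<exists>\<Gamma>\<^sub>0\<subseteq>\<Gamma>. countable \<Gamma>\<^sub>0 \<and> f \<in> weak_star closure_of (convex hull \<Gamma>\<^sub>0)))"

text \<open>Biorthogonality makes \<open>x\<close> injective on \<open>I\<close>, so every Markushevich basis can be reindexed by
  its own set of vectors; index sets inside the type \<open>'a\<close> lose no generality.\<close>

definition WLD :: "'a::real_normed_vector itself \<Rightarrow> bool" where
  "WLD X \<longleftrightarrow>
     (\<exists>(I::'a set) (x::'a \<Rightarrow> 'a) (g::'a \<Rightarrow> 'a \<Rightarrow>\<^sub>L real). markushevich_basis I x g) \<and>
     corson_property_C X"

text \<open>Every function on \<open>'k discrete\<close> is continuous, so \<open>'k discrete \<Rightarrow>\<^sub>C real\<close> is the space of all
  bounded functions on \<open>'k\<close> with the supremum norm, and \<open>\<ell>\<^sup>\<infinity>(\<kappa>)\<close> is the subspace of those vanishing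
  outside \<open>Field \<kappa>\<close>.\<close>

definition linf_omega :: "'k rel \<Rightarrow> ('k discrete \<Rightarrow>\<^sub>C real) set" where
  "linf_omega \<kappa> =
     {u. (\<forall>\<alpha>. \<alpha> \<notin> Field \<kappa> \<longrightarrow> apply_bcontfun u (discrete \<alpha>) = 0) \<and>
         countable {\<alpha>. apply_bcontfun u (discrete \<alpha>) \<noteq> 0}}"

definition isomorphic_to_subspace_of ::
  "'a::real_normed_vector itself \<Rightarrow> 'b::real_normed_vector set \<Rightarrow> bool" where
  "isomorphic_to_subspace_of _ S \<longleftrightarrow>
     (\<exists>Y (T::'a \<Rightarrow> 'b) T'. subspace Y \<and> Y \<subseteq> S \<and> linear T \<and> homeomorphism UNIV Y T T')"

definition embeds_isometrically_into ::
  "'a::real_normed_vector itself \<Rightarrow> 'b::real_normed_vector set \<Rightarrow> bool" where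
  "embeds_isometrically_into _ S \<longleftrightarrow>
     (\<exists>T::'a \<Rightarrow> 'b. linear T \<and> range T \<subseteq> S \<and> (\<forall>x. norm (T x) = norm x))"

definition normalized_on :: "'i set \<Rightarrow> ('i \<Rightarrow> 'a::real_normed_vector) \<Rightarrow> bool" where
  "normalized_on I e \<longleftrightarrow> (\<forall>\<alpha>\<in>I. norm (e \<alpha>) = 1)"

definition suppression_unconditional ::
  "real \<Rightarrow> 'i set \<Rightarrow> ('i \<Rightarrow> 'a::real_normed_vector) \<Rightarrow> bool" where
  "suppression_unconditional C I e \<longleftrightarrow> normalized_on I e \<and>
     (\<forall>A B (c::'i \<Rightarrow> real). finite B \<and> A \<subseteq> B \<and> B \<subseteq> I \<longrightarrow>
        norm (\<Sum>\<alpha>\<in>A. c \<alpha> *\<^sub>R e \<alpha>) \<le> C * norm (\<Sum>\<alpha>\<in>B. c \<alpha> *\<^sub>R e \<alpha>))"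

definition C_unconditional ::
  "real \<Rightarrow> 'i set \<Rightarrow> ('i \<Rightarrow> 'a::real_normed_vector) \<Rightarrow> bool" where
  "C_unconditional C I e \<longleftrightarrow> normalized_on I e \<and>
     (\<forall>A (c::'i \<Rightarrow> real) (\<theta>::'i \<Rightarrow> real). finite A \<and> A \<subseteq> I \<and> (\<forall>\<alpha>\<in>A. \<theta> \<alpha> \<in> {1, -1}) \<longrightarrow>
        norm (\<Sum>\<alpha>\<in>A. c \<alpha> *\<^sub>R e \<alpha>) \<le> C * norm (\<Sum>\<alpha>\<in>A. (\<theta> \<alpha> * c \<alpha>) *\<^sub>R e \<alpha>))"

text \<open>A \<open>C\<close>-unconditional family is \<open>(1 + C) / 2\<close>-suppression unconditional, hence a (transfinite)
  basic sequence with respect to every well-ordering of its index set; no separate basis-constant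
  clause is needed.\<close>

definition unconditional_basic ::
  "'i set \<Rightarrow> ('i \<Rightarrow> 'a::real_normed_vector) \<Rightarrow> bool" where
  "unconditional_basic I e \<longleftrightarrow> (\<exists>C. C_unconditional C I e)"

definition omega1 :: "nat set rel" where
  "omega1 = cardSuc natLeq"

end

theory Submission
  imports Defs "HOL-Library.Countable_Set_Type"
begin

text \<open>
  Property (C) makes every functional vanish at all but countably many vectors of the
  Markushevich basis, while an embedding into \<open>\<ell>\<^sup>\<infinity>\<^sub>\<omega>(\<kappa>)\<close> makes every vector vanish at all but countably
  many coordinate functionals. In the incidence relation between basis vectors and coordinates both
  degrees are therefore countable, so a maximal set of basis vectors with pairwise disjoint supports
  is uncountable. Disjointly supported elements of \<open>\<ell>\<^sup>\<infinity>\<close> span an isometric copy of \<open>c\<^sub>0\<close> after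
  normalization, whence unconditionality.
\<close>

text \<open>The norming condition is dual to an embedding. The scalars \<open>f \<alpha> x\<close>
  serve as coordinates of \<open>x\<close>, and a ball of radius \<open>C\<close> inside the weak*
  closed convex hull says that their supremum is at least \<open>C * norm x\<close>. Passing from
  hulls to norms takes functionals attaining the norm of a given vector; passing back takes
  separation by vectors of the space itself. Hence the two arguments of Hahn-Banach type. As the
  supremum is one-sided, an embedding yields a norming family only after its normalized coordinate
  functionals are taken with both signs. That the basis is uncountable comes from the density: the
  rational span of countably many vectors would be a countable dense set. An embedding with
  \<open>a * norm x \<le> norm (T x) \<le> b * norm x\<close> gives the radius \<open>a / b\<close>
  and the unconditionality constant \<open>b / a\<close>: the comparison of sums costs nothing in
  the supremum norm, so only the distortion of \<open>T\<close> is paid, and it is \<open>1\<close>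
  for an isometry.\<close>

section \<open>Hahn-Banach via minimal sublinear functionals\<close>

text \<open>Homogeneity is demanded as \<open>\<le>\<close> only, which leaves less to check for
  infima. Using it with \<open>1 / r\<close> gives equality for \<open>r > 0\<close>, so these are
  the usual sublinear functionals.\<close>

definition sublinear :: "('a::real_vector \<Rightarrow> real) \<Rightarrow> bool" where
  "sublinear p \<longleftrightarrow> (\<forall>x y. p (x + y) \<le> p x + p y) \<and> (\<forall>r\<ge>0. \<forall>x. p (r *\<^sub>R x) \<le> r * p x)"

lemma sublinear_add: "sublinear p \<Longrightarrow> p (x + y) \<le> p x + p y"
  by (simp add: sublinear_def)

lemma sublinear_scale: "sublinear p \<Longrightarrow> r \<ge> 0 \<Longrightarrow> p (r *\<^sub>R x) \<le> r * p x"
  by (simp add: sublinear_def)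

lemma sublinear_zero: "sublinear p \<Longrightarrow> p 0 = 0"
  using sublinear_scale[of p 0 0] sublinear_add[of p 0 0] by simp

lemma sublinear_neg_le: "sublinear p \<Longrightarrow> - p (- x) \<le> p x"
  using sublinear_add[of p x "- x"] sublinear_zero[of p] by simp

text \<open>Hahn-Banach without extending step by step: a minimal sublinear functional coincides with its
  reduction \<open>q y = (INF t\<in>{0..}. p (y + t z) - t p z)\<close> in every direction \<open>z\<close>, hence is odd and linear.\<close>

lemma sublinear_reduce:
  assumes p: "sublinear p"
  obtains q where "sublinear q" "q \<le> p" "q (- z) \<le> - p z"
proof -
  define G where "G = (\<lambda>y t. p (y + t *\<^sub>R z) - t * p z)"
  define q where "q = (\<lambda>y. INF t\<in>{0..}. G y t)"
  have bdd: "bdd_below (G y ` {0..})" for y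
  proof (rule bdd_belowI2)
    fix t :: real assume "t \<in> {0..}"
    show "- p (- y) \<le> G y t"
    proof (cases "t = 0")
      case True
      then show ?thesis using sublinear_neg_le[OF p, of y] by (simp add: G_def)
    next
      case False
      then have "t > 0" using \<open>t \<in> {0..}\<close> by simp
      \<comment> \<open>Homogeneity bounds \<open>p\<close> of a multiple from above; applying it
        with the factor \<open>1 / t\<close> to \<open>t *\<^sub>R z\<close> gives the lower bound
        for \<open>p (t *\<^sub>R z)\<close>.\<close>
      have "p z = p ((1 / t) *\<^sub>R (t *\<^sub>R z))" using False by simp
      also have "\<dots> \<le> (1 / t) * p (t *\<^sub>R z)"
        using \<open>t > 0\<close> by (intro sublinear_scale[OF p]) simp
      finally have "t * p z \<le> p (t *\<^sub>R z)"
        using \<open>t > 0\<close> by (simp add: field_simps)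
      also have "\<dots> \<le> p (y + t *\<^sub>R z) + p (- y)"
        using sublinear_add[OF p, of "y + t *\<^sub>R z" "- y"] by simp
      finally show ?thesis by (simp add: G_def)
    qed
  qed
  have qG: "q y \<le> G y t" if "t \<ge> 0" for y t
    unfolding q_def using that by (intro cINF_lower[OF bdd]) simp
  have Gq: "b \<le> q y" if "\<And>t. t \<ge> 0 \<Longrightarrow> b \<le> G y t" for b y
    unfolding q_def using that by (intro cINF_greatest) auto
  have "q \<le> p"
    using qG[of 0] by (auto simp: le_fun_def G_def)
  \<comment> \<open>At \<open>y = - z\<close> the choice \<open>t = 1\<close> makes the argument of
    \<open>p\<close> zero and leaves \<open>- p z\<close>.\<close>
  moreover have "q (- z) \<le> - p z"
    using qG[of 1 "- z"] sublinear_zero[OF p] by (simp add: G_def)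
  moreover have "sublinear q"
    unfolding sublinear_def
  proof (intro conjI allI impI)
    fix x y
    \<comment> \<open>The parameters of the two summands add up; the infimum is then taken over
      \<open>s\<close> and \<open>t\<close> separately.\<close>
    have "q (x + y) \<le> G x s + G y t" if "s \<ge> 0" "t \<ge> 0" for s t
    proof -
      have "q (x + y) \<le> G (x + y) (s + t)" using that by (intro qG) simp
      also have "\<dots> \<le> G x s + G y t"
        using sublinear_add[OF p, of "x + s *\<^sub>R z" "y + t *\<^sub>R z"]
        by (simp add: G_def algebra_simps)
      finally show ?thesis .
    qed
    then have "q (x + y) - G y t \<le> q x" if "t \<ge> 0" for t
      using that by (intro Gq) (smt (verit))
    then have "q (x + y) - q x \<le> q y"
      by (intro Gq) (smt (verit))
    then show "q (x + y) \<le> q x + q y" by simp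
  next
    fix r :: real and x assume r: "r \<ge> 0"
    show "q (r *\<^sub>R x) \<le> r * q x"
    proof (cases "r = 0")
      case True
      then show ?thesis using qG[of 0 0] sublinear_zero[OF p] by (simp add: G_def)
    next
      case False
      have "q (r *\<^sub>R x) / r \<le> G x t" if "t \<ge> 0" for t
      proof -
        have "q (r *\<^sub>R x) \<le> G (r *\<^sub>R x) (r * t)" using that r by (intro qG) simp
        also have "\<dots> \<le> r * G x t"
          using sublinear_scale[OF p r, of "x + t *\<^sub>R z"] by (simp add: G_def algebra_simps)
        finally show ?thesis using r False by (simp add: field_simps)
      qed
      then have "q (r *\<^sub>R x) / r \<le> q x" by (rule Gq)
      then show ?thesis using r False by (simp add: field_simps)
    qed
  qed
  ultimately show ?thesis using that by blast
qed

text \<open>Zorn's lemma downwards. The pointwise infimum of a chain is finite, since each member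
  satisfies \<open>q x \<ge> - q (- x) \<ge> - p (- x)\<close>, and it is subadditive because any
  two members of the chain dominate a common one.\<close>

lemma minimal_sublinear_exists:
  assumes p: "sublinear p"
  obtains m where "sublinear m" "m \<le> p" "\<And>q. sublinear q \<Longrightarrow> q \<le> m \<Longrightarrow> q = m"
proof -
  let ?A = "{q. sublinear q \<and> q \<le> p}"
  \<comment> \<open>The order is reversed, so that a maximal element for \<open>?P\<close> is a
    minimal functional.\<close>
  let ?P = "\<lambda>q r :: 'a \<Rightarrow> real. r \<le> q"
  have po: "partial_order_on ?A (relation_of ?P ?A)"
    by (rule partial_order_on_relation_ofI) auto
  have "\<exists>m\<in>?A. \<forall>q\<in>?A. ?P m q \<longrightarrow> q = m"
  proof (rule predicate_Zorn[OF po])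
    fix C assume C: "C \<in> Chains (relation_of ?P ?A)"
    have CA: "\<And>q. q \<in> C \<Longrightarrow> sublinear q \<and> q \<le> p"
      using Chains_relation_of[OF C] by auto
    have ch: "q \<le> r \<or> r \<le> q" if "q \<in> C" "r \<in> C" for q r
      using C that unfolding Chains_def relation_of_def by blast
    show "\<exists>u\<in>?A. \<forall>q\<in>C. ?P q u"
    proof (cases "C = {}")
      case True
      then show ?thesis using p by blast
    next
      case False
      define u where "u = (\<lambda>x. INF q\<in>C. q x)"
      have bdd: "bdd_below ((\<lambda>q. q x) ` C)" for x
      proof (rule bdd_belowI2)
        fix q assume "q \<in> C"
        then show "- p (- x) \<le> q x"
          using CA[of q] sublinear_neg_le[of q x] le_funD[of q p "- x"] by simp
      qed
      have lower: "u x \<le> q x" if "q \<in> C" for q x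
        unfolding u_def using that by (intro cINF_lower[OF bdd])
      have greatest: "b \<le> u x" if "\<And>q. q \<in> C \<Longrightarrow> b \<le> q x" for b x
        unfolding u_def using that False by (intro cINF_greatest) auto
      have "u (x + y) \<le> u x + u y" for x y
      proof -
        have "u (x + y) \<le> q x + r y" if qr: "q \<in> C" "r \<in> C" for q r
        proof -
          obtain s where "s \<in> C" "s \<le> q" "s \<le> r" using ch[OF qr] qr by blast
          then show ?thesis
            using lower[of s "x + y"] sublinear_add[of s x y] CA[of s] le_funD[of s q x]
              le_funD[of s r y] by linarith
        qed
        then have "u (x + y) - r y \<le> u x" if "r \<in> C" for r
          using that by (intro greatest) (smt (verit))
        then have "u (x + y) - u x \<le> u y"
          by (intro greatest) (smt (verit))
        then show ?thesis by simp
      qed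
      moreover have "u (r *\<^sub>R x) \<le> r * u x" if r: "r \<ge> 0" for r x
      proof (cases "r = 0")
        case True
        obtain q where "q \<in> C" using False by blast
        then show ?thesis using True lower[of q 0] CA[of q] sublinear_zero[of q] by simp
      next
        case rn: False
        have "u (r *\<^sub>R x) / r \<le> q x" if "q \<in> C" for q
          using lower[OF that, of "r *\<^sub>R x"] sublinear_scale[of q r x] CA[OF that] r rn
          by (simp add: field_simps)
        then have "u (r *\<^sub>R x) / r \<le> u x" by (rule greatest)
        then show ?thesis using r rn by (simp add: field_simps)
      qed
      ultimately have "sublinear u" by (simp add: sublinear_def)
      moreover obtain q where "q \<in> C" using False by blast
      then have "u \<le> p"
        using lower CA[of q] unfolding le_fun_def by (meson order_trans)
      ultimately show ?thesis using lower by (auto simp: le_fun_def)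
    qed
  qed
  then obtain m where "sublinear m" "m \<le> p" and
    "\<And>q. sublinear q \<Longrightarrow> q \<le> p \<Longrightarrow> q \<le> m \<Longrightarrow> q = m"
    by blast
  then show ?thesis using that order_trans[of _ m p] by blast
qed

text \<open>Minimality forces the reduction to equal \<open>m\<close>, which gives oddness. Each
  one-sided inequality, used at a vector and at its negative, then becomes an equality.\<close>

lemma minimal_sublinear_linear:
  assumes m: "sublinear m" and min: "\<And>q. sublinear q \<Longrightarrow> q \<le> m \<Longrightarrow> q = m"
  shows "linear m"
proof -
  have neg: "m (- x) = - m x" for x
  proof -
    obtain q where "sublinear q" "q \<le> m" "q (- x) \<le> - m x" using sublinear_reduce[OF m] by blast
    then show ?thesis using min[of q] sublinear_neg_le[OF m, of x] by auto
  qed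
  show ?thesis
  proof (rule linearI)
    fix x y
    show "m (x + y) = m x + m y"
      using sublinear_add[OF m, of x y] sublinear_add[OF m, of "- x" "- y"] neg[of x] neg[of y]
        neg[of "x + y"] by simp
  next
    fix r :: real and x
    have *: "m (r *\<^sub>R x) = r * m x" if "r \<ge> 0" for r x
      using sublinear_scale[OF m that, of x] sublinear_scale[OF m that, of "- x"] neg[of x]
        neg[of "r *\<^sub>R x"] by simp
    show "m (r *\<^sub>R x) = r *\<^sub>R m x"
    proof (cases "r \<ge> 0")
      case False
      then show ?thesis using *[of "- r" x] neg[of "r *\<^sub>R x"] by simp
    qed (simp add: *)
  qed
qed

text \<open>The norm is reduced in direction \<open>x\<close> before minimising: the bound
  \<open>p (- x) \<le> - norm x\<close> is inherited by every smaller functional, and for a linear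
  one below the norm it forces the value \<open>norm x\<close> at \<open>x\<close>.\<close>

lemma norm_attaining_functional:
  fixes x :: "'a::real_normed_vector"
  obtains h :: "'a \<Rightarrow>\<^sub>L real" where "norm h \<le> 1" "blinfun_apply h x = norm x"
proof -
  have "sublinear (norm :: 'a \<Rightarrow> real)"
    by (simp add: sublinear_def norm_triangle_ineq)
  then obtain p :: "'a \<Rightarrow> real" where p: "sublinear p" "p \<le> norm" "p (- x) \<le> - norm x"
    using sublinear_reduce by blast
  obtain m where m: "sublinear m" "m \<le> p" "\<And>q. sublinear q \<Longrightarrow> q \<le> m \<Longrightarrow> q = m"
    using minimal_sublinear_exists[OF p(1)] by blast
  have lin: "linear m" using minimal_sublinear_linear m by blast
  have le: "m y \<le> norm y" for y using le_funD[OF m(2)] le_funD[OF p(2)] by (rule order_trans)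
  have ab: "\<bar>m y\<bar> \<le> norm y" for y
    using le[of y] le[of "- y"] linear_neg[OF lin, of y] by simp
  have bl: "bounded_linear m"
    using lin ab by (intro bounded_linear_intro[where K = 1]) (auto simp: linear_add linear_scale)
  then have ap: "blinfun_apply (Blinfun m) = m" by (rule bounded_linear_Blinfun_apply)
  have "norm (Blinfun m) \<le> 1"
    by (rule norm_blinfun_bound) (auto simp: ap ab)
  moreover have "m x = norm x"
    using le[of x] le_funD[OF m(2), of "- x"] p(3) linear_neg[OF lin, of x] by simp
  ultimately show ?thesis using that[of "Blinfun m"] ap by simp
qed

section \<open>Weak* topology: half-spaces, neighbourhoods, separation\<close>

lemma weak_star_closed_halfspace:
  fixes h :: "'a::real_normed_vector \<Rightarrow>\<^sub>L real"
  assumes "h \<in> weak_star closure_of K" "\<And>k. k \<in> K \<Longrightarrow> blinfun_apply k x \<le> b"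
  shows "blinfun_apply h x \<le> b"
proof (rule ccontr)
  assume "\<not> ?thesis"
  \<comment> \<open>The one-point index set \<open>{()}\<close> gives the open half-space the shape
    of a basic open set in \<open>strong_operator_topology_basis\<close>.\<close>
  then have "h \<in> {k. \<forall>i\<in>{()}. blinfun_apply k x \<in> {b<..}}" by simp
  moreover have "openin weak_star {k :: 'a \<Rightarrow>\<^sub>L real. \<forall>i\<in>{()}. blinfun_apply k x \<in> {b<..}}"
    by (rule strong_operator_topology_basis) auto
  ultimately obtain k where "k \<in> K" "k \<in> {k. \<forall>i\<in>{()}. blinfun_apply k x \<in> {b<..}}"
    using assms(1) unfolding in_closure_of by meson
  then show False using assms(2)[of k] by simp
qed

text \<open>The topology is pulled back from the product topology, where an open box restricts only
  finitely many coordinates; one radius serves for all of these.\<close>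

lemma weak_star_nhd:
  fixes h :: "'a::real_normed_vector \<Rightarrow>\<^sub>L real"
  assumes "openin weak_star T" "h \<in> T"
  obtains F e where "finite F" "e > 0"
    "\<And>k. (\<And>x. x \<in> F \<Longrightarrow> \<bar>blinfun_apply h x - blinfun_apply k x\<bar> < e) \<Longrightarrow> k \<in> T"
proof -
  obtain U where U: "open U" "T = blinfun_apply -` U"
    using assms(1) unfolding strong_operator_topology_def openin_pullback_topology by auto
  have "openin (product_topology (\<lambda>i::'a. euclidean :: real topology) UNIV) U"
    using U(1) by (simp add: open_fun_def)
  from product_topology_open_contains_basis[OF this, of "blinfun_apply h"]
  obtain X where X: "\<And>i. blinfun_apply h i \<in> X i" "\<And>i. open (X i)" "finite {i. X i \<noteq> UNIV}"
     "Pi UNIV X \<subseteq> U"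
    using assms(2) U(2) by (auto simp: PiE_UNIV_domain)
  define F where "F = {i. X i \<noteq> UNIV}"
  have "\<exists>e>0. ball (blinfun_apply h i) e \<subseteq> X i" for i
    using X(1,2) open_contains_ball by blast
  then obtain e where e: "\<And>i. e i > 0" "\<And>i. ball (blinfun_apply h i) (e i) \<subseteq> X i"
    by metis
  \<comment> \<open>Inserting \<open>1\<close> keeps the minimum meaningful when no coordinate is
    restricted.\<close>
  define d where "d = Min (insert 1 (e ` F))"
  have fin: "finite F" using X(3) by (simp add: F_def)
  have "d > 0" using fin e(1) by (auto simp: d_def)
  moreover have "k \<in> T" if k: "\<And>x. x \<in> F \<Longrightarrow> \<bar>blinfun_apply h x - blinfun_apply k x\<bar> < d" for k
  proof -
    have "blinfun_apply k i \<in> X i" for i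
    proof (cases "i \<in> F")
      case True
      then have "d \<le> e i" using fin by (auto simp: d_def)
      then have "blinfun_apply k i \<in> ball (blinfun_apply h i) (e i)"
        using k[OF True] by (simp add: dist_real_def)
      then show ?thesis using e(2) by blast
    qed (simp add: F_def)
    then show ?thesis using X(4) U(2) by auto
  qed
  ultimately show ?thesis using that fin by blast
qed

text \<open>The separating vector \<open>z\<close> is \<open>h - k\<close> in finitely many coordinates, where \<open>k \<in> K\<close> almost minimises
  the Euclidean distance to \<open>h\<close> in these coordinates.\<close>

lemma weak_star_separation:
  fixes h :: "'a::real_normed_vector \<Rightarrow>\<^sub>L real"
  assumes K: "convex K" "bounded K"
    and sep: "\<And>x b. (\<And>k. k \<in> K \<Longrightarrow> blinfun_apply k x \<le> b) \<Longrightarrow> blinfun_apply h x \<le> b"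
  shows "h \<in> weak_star closure_of K"
proof -
  \<comment> \<open>For empty \<open>K\<close> the premise of \<open>sep\<close> is vacuous at
    \<open>x = 0\<close>, \<open>b = -1\<close>, which would give \<open>0 \<le> -1\<close>.\<close>
  have ne: "K \<noteq> {}"
    using sep[of 0 "-1"] by auto
  obtain R where R: "\<And>k. k \<in> K \<Longrightarrow> norm k \<le> R" using K(2) by (auto simp: bounded_iff)
  have "\<exists>k\<in>K. k \<in> T" if T: "openin weak_star T" "h \<in> T" for T
  proof (rule ccontr)
    assume none: "\<not> ?thesis"
    obtain F e where F: "finite F" "e > 0"
      "\<And>k. (\<And>x. x \<in> F \<Longrightarrow> \<bar>blinfun_apply h x - blinfun_apply k x\<bar> < e) \<Longrightarrow> k \<in> T"
      using weak_star_nhd[OF T] by blast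
    define d where "d = (\<lambda>k. \<Sum>x\<in>F. (blinfun_apply h x - blinfun_apply k x)\<^sup>2)"
    define D where "D = (INF k\<in>K. d k)"
    \<comment> \<open>Two members of \<open>K\<close> differ by at most \<open>2 * R\<close> in
      norm, so \<open>M\<close> bounds their squared distance in the coordinates
      \<open>F\<close>.\<close>
    define M where "M = (\<Sum>x\<in>F. (2 * R * norm x)\<^sup>2)"
    have bdd: "bdd_below (d ` K)"
      by (rule bdd_belowI2[where m = 0]) (auto simp: d_def sum_nonneg)
    have de: "e\<^sup>2 \<le> d k" if k: "k \<in> K" for k
    proof -
      obtain x where x: "x \<in> F" "\<bar>blinfun_apply h x - blinfun_apply k x\<bar> \<ge> e"
        using F(3)[of k] none k by force
      then have "e\<^sup>2 \<le> (blinfun_apply h x - blinfun_apply k x)\<^sup>2"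
        using F(2) by (metis abs_le_square_iff abs_of_pos)
      also have "\<dots> \<le> d k"
        unfolding d_def using x(1) F(1) by (intro member_le_sum) auto
      finally show ?thesis .
    qed
    have "e\<^sup>2 \<le> D" unfolding D_def using ne de by (intro cINF_greatest) auto
    then have Dpos: "D > 0" using F(2) by (smt (verit) zero_less_power)
    have DK: "D \<le> d k" if "k \<in> K" for k
      unfolding D_def by (rule cINF_lower[OF bdd that])
    have Mpos: "M \<ge> 0" by (auto simp: M_def sum_nonneg)
    \<comment> \<open>Moving from \<open>k\<close> towards \<open>j\<close> by the fraction
      \<open>l\<close> changes \<open>d\<close> by \<open>- 2 * l * (j z - k z)\<close> plus a term
      of at most \<open>l\<^sup>2 * M\<close>. This \<open>l\<close> makes the latter at most
      \<open>l * D / 2\<close>; with \<open>k\<close> within \<open>l * D / 2\<close> of the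
      infimum, \<open>j z - k z \<le> D / 2\<close> follows. The summand in \<open>M + 1\<close>
      avoids division by zero.\<close>
    define l where "l = min 1 (D / (2 * (M + 1)))"
    have l: "0 < l" "l \<le> 1" "l * M \<le> D / 2"
    proof -
      show "0 < l" "l \<le> 1" using Dpos Mpos by (auto simp: l_def)
      have "l * M \<le> D / (2 * (M + 1)) * (M + 1)"
        using Mpos Dpos by (intro mult_mono) (auto simp: l_def)
      also have "\<dots> = D / 2" using Mpos by (simp add: field_simps)
      finally show "l * M \<le> D / 2" .
    qed
    have "D < D + l * D / 2" using l Dpos by simp
    then obtain k where k: "k \<in> K" "d k < D + l * D / 2"
      unfolding D_def using cINF_less_iff[OF ne bdd] by blast
    define z where "z = (\<Sum>x\<in>F. (blinfun_apply h x - blinfun_apply k x) *\<^sub>R x)"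
    have app: "blinfun_apply j z
        = (\<Sum>x\<in>F. (blinfun_apply h x - blinfun_apply k x) * blinfun_apply j x)" for j
      by (simp add: z_def blinfun.sum_right blinfun.scaleR_right)
    have hk: "blinfun_apply h z - blinfun_apply k z = d k"
      by (simp add: app d_def sum_subtractf[symmetric] algebra_simps power2_eq_square)
    have "blinfun_apply j z \<le> blinfun_apply k z + D / 2" if j: "j \<in> K" for j
    proof -
      have "(1 - l) *\<^sub>R k + l *\<^sub>R j \<in> K"
        using K(1) k(1) j l by (intro convexD) auto
      then have "D \<le> d ((1 - l) *\<^sub>R k + l *\<^sub>R j)" by (rule DK)
      also have "\<dots> = d k - 2 * l * (blinfun_apply j z - blinfun_apply k z)
          + l\<^sup>2 * (\<Sum>x\<in>F. (blinfun_apply j x - blinfun_apply k x)\<^sup>2)"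
        unfolding d_def app sum_subtractf[symmetric] sum_distrib_left sum.distrib[symmetric]
        by (intro sum.cong refl, unfold blinfun.add_left blinfun.scaleR_left real_scaleR_def)
          algebra
      also have "(\<Sum>x\<in>F. (blinfun_apply j x - blinfun_apply k x)\<^sup>2) \<le> M"
        unfolding M_def
      proof (rule sum_mono)
        fix x
        have "\<bar>blinfun_apply j x - blinfun_apply k x\<bar> \<le> norm (j - k) * norm x"
          using norm_blinfun[of "j - k" x] by (simp add: blinfun.diff_left)
        also have "\<dots> \<le> 2 * R * norm x"
          using R[OF j] R[OF k(1)] norm_triangle_ineq4[of j k] by (intro mult_right_mono) auto
        finally show "(blinfun_apply j x - blinfun_apply k x)\<^sup>2 \<le> (2 * R * norm x)\<^sup>2"
          by (metis abs_ge_self abs_le_square_iff order_trans)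
      qed
      finally have "D \<le> d k - 2 * l * (blinfun_apply j z - blinfun_apply k z) + l\<^sup>2 * M"
        by (simp add: mult_left_mono)
      also have "l\<^sup>2 * M \<le> l * (D / 2)"
        using l by (simp add: power2_eq_square mult.assoc mult_left_mono)
      finally have "2 * l * (blinfun_apply j z - blinfun_apply k z) \<le> l * D"
        using k(2) by (simp add: field_simps)
      then have "l * (2 * (blinfun_apply j z - blinfun_apply k z)) \<le> l * D"
        by (simp add: algebra_simps)
      then have "2 * (blinfun_apply j z - blinfun_apply k z) \<le> D"
        using l(1) by (simp only: mult_le_cancel_left_pos)
      then show ?thesis by simp
    qed
    \<comment> \<open>All of \<open>K\<close> lies in the half-space with bound
      \<open>k z + D / 2\<close>, whereas \<open>h z\<close> exceeds \<open>k z\<close> by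
      \<open>d k \<ge> D\<close>.\<close>
    then have "blinfun_apply h z \<le> blinfun_apply k z + D / 2" by (rule sep)
    then show False using hk DK[OF k(1)] Dpos by simp
  qed
  then show ?thesis
    by (auto simp: in_closure_of strong_operator_topology_topspace)
qed

section \<open>Isomorphic embeddings as two-sided norm estimates\<close>

text \<open>If the bound failed at \<open>x\<close>, scaling \<open>x\<close> to make
  \<open>norm (v x) = 1\<close> would contradict the local implication. This turns continuity at
  zero into a global estimate.\<close>

lemma linear_bound_transfer:
  fixes u :: "'a::real_vector \<Rightarrow> 'b::real_normed_vector" and v :: "'a \<Rightarrow> 'c::real_normed_vector"
  assumes "linear u" "linear v" and *: "\<And>x. norm (u x) < d \<Longrightarrow> norm (v x) < 1"
  shows "d * norm (v x) \<le> norm (u x)"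
proof (rule ccontr)
  assume n: "\<not> ?thesis"
  then have v: "norm (v x) > 0" by (cases "v x = 0") auto
  let ?y = "(1 / norm (v x)) *\<^sub>R x"
  have "norm (u ?y) < d"
    using n v by (simp add: linear_scale[OF assms(1)] field_simps)
  then have "norm (v ?y) < 1" by (rule *)
  then show False using v by (simp add: linear_scale[OF assms(2)])
qed

text \<open>Continuity of \<open>T\<close> and of \<open>T'\<close> at zero gives the two bounds.
  For the lower one the transfer is applied with \<open>T\<close> as \<open>u\<close> and the
  identity as \<open>v\<close>, so linearity is again only that of \<open>T\<close>.\<close>

lemma isomorphic_to_subspace_ofD:
  fixes S :: "'b::real_normed_vector set"
  assumes "isomorphic_to_subspace_of TYPE('a::real_normed_vector) S"
  obtains T :: "'a::real_normed_vector \<Rightarrow> 'b" and a where "bounded_linear T" "range T \<subseteq> S" "a > 0"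
    "\<And>x. a * norm x \<le> norm (T x)"
proof -
  obtain Y and T :: "'a \<Rightarrow> 'b" and T' where T: "Y \<subseteq> S" "linear T" "homeomorphism UNIV Y T T'"
    using assms unfolding isomorphic_to_subspace_of_def by blast
  have im: "range T = Y" and T'T: "\<And>x. T' (T x) = x" and c: "continuous_on UNIV T"
    and c': "continuous_on Y T'"
    using T(3) by (auto simp: homeomorphism_def)
  have T0: "T 0 = 0" "T' 0 = 0" using linear_0[OF T(2)] T'T[of 0] by auto
  obtain d where d: "d > 0" "\<And>x. norm x < d \<Longrightarrow> norm (T x) < 1"
    using c[unfolded continuous_on_iff, rule_format, of 0 1] T0 by auto
  have "\<exists>e>0. \<forall>y\<in>Y. norm y < e \<longrightarrow> norm (T' y) < 1"
    using c'[unfolded continuous_on_iff, rule_format, of 0 1] T0 im by auto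
  then obtain e where e: "e > 0" "\<And>y. y \<in> Y \<Longrightarrow> norm y < e \<Longrightarrow> norm (T' y) < 1"
    by blast
  have "d * norm (T x) \<le> norm x" for x
    using linear_bound_transfer[of "\<lambda>x. x" T d x] T(2) d(2) by (simp add: linear_iff)
  then have "bounded_linear T"
    using T(2) d(1)
    by (intro bounded_linear_intro[where K = "1 / d"]) (auto simp: linear_add linear_scale field_simps)
  moreover have "e * norm x \<le> norm (T x)" for x
  proof -
    have "norm y < 1" if "norm (T y) < e" for y
      using e(2)[of "T y"] that im T'T[of y] by auto
    then show ?thesis
      using linear_bound_transfer[of T "\<lambda>x. x" e x] T(2) linear_ident by blast
  qed
  ultimately show ?thesis using that T(1) im e(1) by blast
qed

lemma isomorphic_to_subspace_ofI:
  fixes T :: "'a::real_normed_vector \<Rightarrow> 'b::real_normed_vector"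
  assumes T: "bounded_linear T" and "range T \<subseteq> S" and a: "a > 0"
    and low: "\<And>x. a * norm x \<le> norm (T x)"
  shows "isomorphic_to_subspace_of TYPE('a) S"
proof -
  interpret T: bounded_linear T by fact
  have "inj T"
  proof (rule injI)
    fix x y assume "T x = T y"
    then have "a * norm (x - y) \<le> 0" using low[of "x - y"] by (simp add: T.diff)
    then show "x = y" using a by (simp add: mult_le_0_iff)
  qed
  have "continuous_on (range T) (inv T)"
    unfolding continuous_on_iff
  proof (intro ballI allI impI)
    fix y and e :: real assume y: "y \<in> range T" and e: "e > 0"
    have "dist (inv T y') (inv T y) < e" if y': "y' \<in> range T" "dist y' y < a * e" for y'
    proof -
      obtain x x' where x: "y = T x" "y' = T x'" using y y' by blast
      have "a * norm (x' - x) < a * e"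
        using low[of "x' - x"] y'(2) by (simp add: x dist_norm T.diff)
      then show ?thesis using a \<open>inj T\<close> by (simp add: x dist_norm)
    qed
    then show "\<exists>d>0. \<forall>y'\<in>range T. dist y' y < d \<longrightarrow> dist (inv T y') (inv T y) < e"
      using a e by (intro exI[of _ "a * e"]) simp
  qed
  then have "homeomorphism UNIV (range T) T (inv T)"
    using \<open>inj T\<close> by (auto simp: homeomorphism_def T.continuous_on f_inv_into_f)
  moreover have "subspace (range T)"
    using linear_subspace_image[OF T.linear subspace_UNIV] .
  ultimately show ?thesis
    using assms(2) T.linear unfolding isomorphic_to_subspace_of_def by blast
qed

section \<open>Functionals on a Markushevich basis\<close>

text \<open>Property (C) applied to the weak* dense span of the biorthogonal functionals puts each
  functional in the weak* closed span of countably many of them.\<close>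

lemma WLD_countable_supports:
  assumes "WLD TYPE('a::real_normed_vector)"
  obtains S :: "'a::real_normed_vector set" where "0 \<notin> S" "closure (span S) = UNIV"
    "\<And>f :: 'a \<Rightarrow>\<^sub>L real. countable {s \<in> S. blinfun_apply f s \<noteq> 0}"
proof -
  obtain I :: "'a set" and x :: "'a \<Rightarrow> 'a" and g :: "'a \<Rightarrow> 'a \<Rightarrow>\<^sub>L real"
    where bi: "\<And>i j. i \<in> I \<Longrightarrow> j \<in> I \<Longrightarrow> blinfun_apply (g i) (x j) = (if i = j then 1 else 0)"
      and sp: "closure (span (x ` I)) = UNIV" and spg: "weak_star closure_of (span (g ` I)) = UNIV"
    using assms unfolding WLD_def markushevich_basis_def by blast
  have C: "corson_property_C TYPE('a)" using assms by (simp add: WLD_def)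
  have "0 \<notin> x ` I"
  proof
    assume "0 \<in> x ` I"
    then obtain i where "i \<in> I" "x i = 0" by auto
    then show False using bi[of i i] by simp
  qed
  moreover have "countable {s \<in> x ` I. blinfun_apply f s \<noteq> 0}" for f :: "'a \<Rightarrow>\<^sub>L real"
  proof -
    have "f \<in> weak_star closure_of (span (g ` I))" using spg by simp
    then obtain G where G: "G \<subseteq> span (g ` I)" "countable G"
      "f \<in> weak_star closure_of (convex hull G)"
      using C unfolding corson_property_C_def by blast
    have "\<exists>J. finite J \<and> J \<subseteq> I \<and> h \<in> span (g ` J)" if "h \<in> G" for h
    proof -
      have "h \<in> span (g ` I)" using G(1) that by blast
      then obtain t where "finite t" "t \<subseteq> g ` I" "h \<in> span t"
        by (auto simp: span_explicit intro: span_sum span_scale span_base)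
      then show ?thesis by (metis finite_subset_image)
    qed
    then obtain J where J: "\<And>h. h \<in> G \<Longrightarrow> finite (J h) \<and> J h \<subseteq> I \<and> h \<in> span (g ` J h)"
      by metis
    \<comment> \<open>Each member of \<open>G\<close> is a finite combination of biorthogonal
      functionals, so \<open>U\<close> is countable; at \<open>x i\<close> with \<open>i\<close>
      outside \<open>U\<close> all of them vanish by biorthogonality.\<close>
    define U where "U = (\<Union>h\<in>G. J h)"
    have "countable U" unfolding U_def using G(2) J by (auto intro: countable_finite)
    have zero: "blinfun_apply f (x i) = 0" if i: "i \<in> I" "i \<notin> U" for i
    proof -
      have lin: "subspace {k. blinfun_apply k (x i) = 0}"
        by (auto simp: subspace_def blinfun.add_left blinfun.scaleR_left)
      have "blinfun_apply h (x i) = 0" if h: "h \<in> G" for h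
      proof -
        have "blinfun_apply (g j) (x i) = 0" if "j \<in> J h" for j
        proof -
          have "j \<in> I" "j \<noteq> i" using J[OF h] i h that by (auto simp: U_def)
          then show ?thesis using bi i(1) by simp
        qed
        then have "g ` J h \<subseteq> {k. blinfun_apply k (x i) = 0}" by blast
        then have "span (g ` J h) \<subseteq> {k. blinfun_apply k (x i) = 0}"
          using lin by (rule span_minimal)
        then show ?thesis using J[OF h] by blast
      qed
      then have "convex hull G \<subseteq> {k. blinfun_apply k (x i) = 0}"
        using lin by (intro hull_minimal) (auto intro: subspace_imp_convex)
      \<comment> \<open>Vanishing at \<open>x i\<close> passes to the weak* closure as two
        half-space conditions, at \<open>x i\<close> and at \<open>- x i\<close>.\<close>
      then have k: "blinfun_apply k (x i) \<le> 0" "blinfun_apply k (- x i) \<le> 0"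
        if "k \<in> convex hull G" for k
        using that by (auto simp: blinfun.minus_right)
      have "blinfun_apply f (x i) \<le> 0" "blinfun_apply f (- x i) \<le> 0"
        by (rule weak_star_closed_halfspace[OF G(3)], erule k)+
      then show ?thesis by (simp add: blinfun.minus_right)
    qed
    have "{s \<in> x ` I. blinfun_apply f s \<noteq> 0} \<subseteq> x ` U"
      using zero by auto
    then show ?thesis using \<open>countable U\<close> by (meson countable_image countable_subset)
  qed
  ultimately show ?thesis using that sp by blast
qed

section \<open>Density and the size of generating sets\<close>

text \<open>\<open>D n\<close> consists of the sums of \<open>n\<close> rational multiples of
  members of \<open>S\<close>; each stage, and the union of all, stays within the infinite cardinal
  \<open>|A|\<close>. The separate \<open>A\<close> admits both \<open>S\<close> itself and, for
  countable \<open>S\<close>, the natural numbers.\<close>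

lemma ex_dense_card_le:
  fixes S :: "'a::real_normed_vector set" and A :: "'b set"
  assumes A: "infinite A" "|S| \<le>o |A|" and S: "closure (span S) = UNIV"
  shows "\<exists>D::'a set. closure D = UNIV \<and> |D| \<le>o |A|"
proof -
  define D where "D = rec_nat {0} (\<lambda>n E. (\<lambda>(r, s, y). r *\<^sub>R s + y) ` (\<rat> \<times> S \<times> E))"
  have D0: "D 0 = {0}" and DS: "D (Suc n) = (\<lambda>(r, s, y). r *\<^sub>R s + y) ` (\<rat> \<times> S \<times> D n)" for n
    by (auto simp: D_def)
  have nA: "|UNIV :: nat set| \<le>o |A|"
    using A(1) infinite_iff_card_of_nat by blast
  have "|\<rat> :: real set| \<le>o |UNIV :: nat set|"
    using countable_rat countable_card_of_nat by blast
  then have QA: "|\<rat> :: real set| \<le>o |A|" using nA ordLeq_transitive by blast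
  have "|D n| \<le>o |A|" for n
  proof (induction n)
    case 0
    then show ?case
      using A(1) by (simp add: D0 card_of_singl_ordLeq infinite_imp_nonempty)
  next
    case (Suc n)
    have "|(\<rat> :: real set) \<times> S \<times> D n| \<le>o |A|"
      using A QA Suc by (intro card_of_Sigma_ordLeq_infinite ballI) auto
    then show ?case
      unfolding DS using card_of_image ordLeq_transitive by blast
  qed
  then have card: "|\<Union>n. D n| \<le>o |A|"
    using A(1) nA by (intro card_of_UNION_ordLeq_infinite) auto
  have "z \<in> closure (\<Union>n. D n)" if "z \<in> span S" for z
    using that
  proof (induction rule: span_induct_alt)
    case base
    have "0 \<in> D 0" by (simp add: D0)
    then show ?case by (intro subsetD[OF closure_subset] UN_I) auto
  next
    case (step c s y)
    show ?case
      unfolding closure_approachable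
    proof (intro allI impI)
      fix e :: real assume e: "e > 0"
      obtain n y' where y': "y' \<in> D n" "dist y' y < e / 2"
        using step.IH e unfolding closure_approachable by (meson UN_iff half_gt_zero)
      \<comment> \<open>Half of \<open>e\<close> is spent on the rational coefficient, the other
        half on \<open>y'\<close>; \<open>norm s + 1\<close> covers \<open>s = 0\<close>.\<close>
      have "c < c + e / (2 * (norm s + 1))" using e by (simp add: add_nonneg_pos)
      then obtain r where r: "r \<in> \<rat>" "c < r" "r < c + e / (2 * (norm s + 1))"
        using Rats_dense_in_real by blast
      have "norm ((r - c) *\<^sub>R s) \<le> (r - c) * (norm s + 1)"
        using r(2) by (simp add: mult_left_mono)
      also have "\<dots> \<le> e / (2 * (norm s + 1)) * (norm s + 1)"
        using r(3) by (intro mult_right_mono) auto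
      also have "\<dots> = e / 2" by (simp add: field_simps add_nonneg_eq_0_iff)
      finally have "norm ((r - c) *\<^sub>R s) \<le> e / 2" .
      then have "norm ((r - c) *\<^sub>R s + (y' - y)) < e"
        using y'(2) by (intro norm_triangle_lt) (simp add: dist_norm)
      then have "dist (r *\<^sub>R s + y') (c *\<^sub>R s + y) < e"
        by (simp add: dist_norm algebra_simps)
      moreover have "r *\<^sub>R s + y' \<in> D (Suc n)"
        unfolding DS using r(1) y'(1) step.hyps by force
      ultimately show "\<exists>z\<in>\<Union>n. D n. dist z (c *\<^sub>R s + y) < e" by blast
    qed
  qed
  then have "closure (span S) \<subseteq> closure (\<Union>n. D n)"
    by (intro closure_minimal) auto
  then show ?thesis using S card by blast
qed

text \<open>Taking the natural numbers for \<open>A\<close> excludes a countable \<open>S\<close>;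
  after that \<open>S\<close> is infinite and can itself be taken for \<open>A\<close>.\<close>

lemma density_le_card_generators:
  assumes dens: "has_density TYPE('a::real_normed_vector) \<kappa>" and unc: "natLeq <o \<kappa>"
    and S: "closure (span (S :: 'a::real_normed_vector set)) = UNIV"
  shows "\<kappa> \<le>o |S|" "\<not> countable S"
proof -
  have le: "\<kappa> \<le>o |A|" if "infinite A" "|S| \<le>o |A|" for A :: "'c set"
    using ex_dense_card_le[OF that S] dens ordLeq_transitive unfolding has_density_def by blast
  show nc: "\<not> countable S"
  proof
    assume "countable S"
    then have "\<kappa> \<le>o |UNIV :: nat set|"
      by (intro le) (auto simp: countable_card_of_nat)
    then have "\<kappa> \<le>o natLeq" using card_of_nat ordLeq_ordIso_trans by blast
    then show False using unc not_ordLess_ordLeq by blast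
  qed
  then show "\<kappa> \<le>o |S|"
    by (intro le) (auto simp: countable_finite intro: card_of_mono1)
qed

section \<open>Disjoint families in a relation with countable degrees\<close>

text \<open>By maximality every index outside \<open>J\<close> has a set meeting some
  \<open>S j\<close> with \<open>j \<in> J\<close>. For countable \<open>J\<close> these sets cover
  only countably many points, each lying in countably many \<open>S i\<close>, so \<open>I\<close>
  would be countable.\<close>

lemma uncountable_disjoint_subfamily:
  assumes I: "\<not> countable I" and supp: "\<And>i. i \<in> I \<Longrightarrow> countable (S i)"
    and pt: "\<And>\<gamma>. countable {i \<in> I. \<gamma> \<in> S i}"
  obtains J where "J \<subseteq> I" "\<not> countable J" "disjoint_family_on S J"
proof -
  let ?R = "\<lambda>i j. S i \<inter> S j = {}"
  let ?A = "{J. J \<subseteq> I \<and> pairwise ?R J}"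
  have "\<forall>C\<in>chains ?A. \<Union>C \<in> ?A"
  proof
    fix C assume "C \<in> chains ?A"
    then have "C \<subseteq> ?A" "chain\<^sub>\<subseteq> C" by (auto simp: chains_def)
    then show "\<Union>C \<in> ?A" using pairwise_chain_Union[of C ?R] by blast
  qed
  from Zorn_Lemma[OF this] obtain J where "J \<in> ?A" and
    mx: "\<forall>K\<in>?A. J \<subseteq> K \<longrightarrow> K = J" by (rule bexE)
  then have J: "J \<subseteq> I" "pairwise ?R J" by simp_all
  have "\<not> countable J"
  proof
    assume cJ: "countable J"
    have "I \<subseteq> J \<union> (\<Union>j\<in>J. \<Union>\<gamma>\<in>S j. {i \<in> I. \<gamma> \<in> S i})"
    proof
      fix i assume i: "i \<in> I"
      show "i \<in> J \<union> (\<Union>j\<in>J. \<Union>\<gamma>\<in>S j. {i \<in> I. \<gamma> \<in> S i})"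
      proof (rule ccontr)
        assume n: "\<not> ?thesis"
        then have "S i \<inter> S j = {}" if "j \<in> J" for j using i that by blast
        then have "pairwise ?R (insert i J)"
          using J(2) by (simp add: pairwise_insert Int_commute)
        then have "insert i J = J" using i J(1) by (intro mx[rule_format]) auto
        then show False using n by blast
      qed
    qed
    moreover have "countable (J \<union> (\<Union>j\<in>J. \<Union>\<gamma>\<in>S j. {i \<in> I. \<gamma> \<in> S i}))"
      using cJ supp J(1) pt by (intro countable_Un countable_UN) auto
    ultimately show False using I countable_subset by blast
  qed
  then show ?thesis
    using that J by (auto simp: disjoint_family_on_def pairwise_def)
qed

section \<open>Unconditionality from disjoint supports\<close>

lemma apply_bcontfun_sum: "apply_bcontfun (sum u B) x = (\<Sum>i\<in>B. apply_bcontfun (u i) x)"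
  by (induction B rule: infinite_finite_induct) auto

text \<open>At each point at most one \<open>u i\<close> with \<open>i \<in> B\<close> is nonzero,
  so both sums reduce to a single term there. Allowing \<open>A \<subseteq> B\<close> and
  \<open>\<bar>c i\<bar> \<le> \<bar>d i\<bar>\<close> together covers suppression as well as
  changes of sign.\<close>

lemma norm_sum_disjoint_supports_le:
  fixes u :: "'i \<Rightarrow> ('b::topological_space \<Rightarrow>\<^sub>C real)"
  assumes B: "finite B" "A \<subseteq> B"
    and disj: "disjoint_family_on (\<lambda>i. {x. apply_bcontfun (u i) x \<noteq> 0}) B"
    and le: "\<And>i. i \<in> B \<Longrightarrow> \<bar>c i\<bar> \<le> \<bar>d i\<bar>"
  shows "norm (\<Sum>i\<in>A. c i *\<^sub>R u i) \<le> norm (\<Sum>i\<in>B. d i *\<^sub>R u i)"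
proof (rule norm_bound)
  fix x
  have *: "apply_bcontfun (\<Sum>i\<in>C. a i *\<^sub>R u i) x = a j * apply_bcontfun (u j) x"
    if "C \<subseteq> B" "j \<in> C" "apply_bcontfun (u j) x \<noteq> 0" for C j a
  proof -
    have "apply_bcontfun (u i) x = 0" if "i \<in> C - {j}" for i
      using disj \<open>C \<subseteq> B\<close> \<open>j \<in> C\<close> \<open>apply_bcontfun (u j) x \<noteq> 0\<close> that
      unfolding disjoint_family_on_def by blast
    then have "(\<Sum>i\<in>C - {j}. a i * apply_bcontfun (u i) x) = 0" by simp
    then show ?thesis
      using that B(1) by (simp add: apply_bcontfun_sum sum.remove[of C j] finite_subset)
  qed
  show "norm (apply_bcontfun (\<Sum>i\<in>A. c i *\<^sub>R u i) x) \<le> norm (\<Sum>i\<in>B. d i *\<^sub>R u i)"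
  proof (cases "\<exists>j\<in>A. apply_bcontfun (u j) x \<noteq> 0")
    case True
    then obtain j where j: "j \<in> A" "apply_bcontfun (u j) x \<noteq> 0" by blast
    then have "norm (apply_bcontfun (\<Sum>i\<in>A. c i *\<^sub>R u i) x)
        \<le> norm (apply_bcontfun (\<Sum>i\<in>B. d i *\<^sub>R u i) x)"
      using *[of A j c] *[of B j d] B(2) le[of j]
      by (auto simp: abs_mult intro: mult_right_mono)
    also have "\<dots> \<le> norm (\<Sum>i\<in>B. d i *\<^sub>R u i)" by (rule norm_bounded)
    finally show ?thesis .
  next
    case False
    then show ?thesis by (simp add: apply_bcontfun_sum)
  qed
qed

text \<open>Sums are compared after applying \<open>T\<close>: going there costs the factor
  \<open>b\<close>, coming back \<open>1 / a\<close>.\<close>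

lemma linf_omega_embedding_unconditional:
  fixes T :: "'a::real_normed_vector \<Rightarrow> ('k discrete \<Rightarrow>\<^sub>C real)"
  assumes wld: "WLD TYPE('a)" and dens: "has_density TYPE('a) \<kappa>'" "natLeq <o \<kappa>'"
    and T: "bounded_linear T" and ran: "range T \<subseteq> linf_omega \<kappa>"
    and a: "a > 0" and low: "\<And>x. a * norm x \<le> norm (T x)" and up: "\<And>x. norm (T x) \<le> b * norm x"
  obtains e :: "nat set \<Rightarrow> 'a" where
    "C_unconditional (b / a) (Field omega1) e" "suppression_unconditional (b / a) (Field omega1) e"
proof -
  interpret T: bounded_linear T by fact
  obtain S :: "'a set" where S: "0 \<notin> S" "closure (span S) = UNIV"
    and cS: "\<And>f :: 'a \<Rightarrow>\<^sub>L real. countable {s \<in> S. blinfun_apply f s \<noteq> 0}"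
    using WLD_countable_supports[OF wld] by blast
  define supp where "supp = (\<lambda>s. {\<gamma>. apply_bcontfun (T s) \<gamma> \<noteq> 0})"
  have csupp: "countable (supp s)" for s
  proof -
    have "countable {\<gamma>. apply_bcontfun (T s) (discrete \<gamma>) \<noteq> 0}"
      using ran by (auto simp: linf_omega_def)
    moreover have "supp s \<subseteq> discrete ` {\<gamma>. apply_bcontfun (T s) (discrete \<gamma>) \<noteq> 0}"
    proof
      fix \<gamma> assume "\<gamma> \<in> supp s"
      then show "\<gamma> \<in> discrete ` {\<gamma>. apply_bcontfun (T s) (discrete \<gamma>) \<noteq> 0}"
        by (intro image_eqI[of _ _ "of_discrete \<gamma>"]) (auto simp: supp_def of_discrete_inverse)
    qed
    ultimately show ?thesis by (meson countable_image countable_subset)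
  qed
  \<comment> \<open>Evaluating \<open>T\<close> at a coordinate is a bounded functional, so
    \<open>cS\<close> applies to it.\<close>
  have pt: "countable {s \<in> S. \<gamma> \<in> supp s}" for \<gamma>
  proof -
    have "bounded_linear (\<lambda>x. apply_bcontfun (T x) \<gamma>)"
    proof (rule bounded_linear_intro)
      show "norm (apply_bcontfun (T x) \<gamma>) \<le> norm x * b" for x
        using norm_bounded[of "T x" \<gamma>] up[of x] by (simp add: mult.commute)
    qed (auto simp: T.add T.scaleR)
    then show ?thesis
      using cS[of "Blinfun (\<lambda>x. apply_bcontfun (T x) \<gamma>)"]
      by (simp add: supp_def bounded_linear_Blinfun_apply)
  qed
  obtain J where J: "J \<subseteq> S" "\<not> countable J" "disjoint_family_on supp J"
    by (rule uncountable_disjoint_subfamily[OF density_le_card_generators(2)[OF dens S(2)] csupp pt])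
  \<comment> \<open>\<open>omega1\<close> is the cardinal successor of \<open>natLeq\<close>, so
    being uncountable is enough for \<open>J\<close> to contain a copy of its field.\<close>
  have "natLeq <o |J|"
    using J(2) countable_card_le_natLeq[of J] natLeq_Well_order card_of_Well_order[of J]
      not_ordLeq_iff_ordLess by blast
  then have "omega1 \<le>o |J|"
    unfolding omega1_def using cardSuc_ordLess_ordLeq natLeq_Card_order card_of_Card_order by blast
  moreover have "|Field omega1| =o omega1"
    unfolding omega1_def by (intro card_of_Field_ordIso cardSuc_Card_order natLeq_Card_order)
  ultimately have "|Field omega1| \<le>o |J|" using ordIso_ordLeq_trans by blast
  from card_of_ordLeq[THEN iffD2, OF this] obtain \<phi> where \<phi>: "inj_on \<phi> (Field omega1)" "\<phi> ` Field omega1 \<subseteq> J"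
    by blast
  \<comment> \<open>Normalization takes place in the domain; the nonzero factors leave the supports
    of the images unchanged.\<close>
  define e where "e = (\<lambda>\<xi>. (1 / norm (\<phi> \<xi>)) *\<^sub>R \<phi> \<xi>)"
  have "\<phi> \<xi> \<noteq> 0" if "\<xi> \<in> Field omega1" for \<xi>
  proof -
    have "\<phi> \<xi> \<in> S" using that \<phi>(2) J(1) by blast
    then show ?thesis using S(1) by metis
  qed
  then have nrm: "normalized_on (Field omega1) e" by (simp add: normalized_on_def e_def)
  have disj: "disjoint_family_on (\<lambda>\<xi>. {\<gamma>. apply_bcontfun (T (e \<xi>)) \<gamma> \<noteq> 0}) (Field omega1)"
    unfolding disjoint_family_on_def
  proof (intro ballI impI)
    fix \<xi> \<eta> assume *: "\<xi> \<in> Field omega1" "\<eta> \<in> Field omega1" "\<xi> \<noteq> \<eta>"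
    then have "\<phi> \<xi> \<in> J" "\<phi> \<eta> \<in> J" "\<phi> \<xi> \<noteq> \<phi> \<eta>" using \<phi> by (auto simp: inj_on_eq_iff)
    then have "supp (\<phi> \<xi>) \<inter> supp (\<phi> \<eta>) = {}" using J(3) by (auto simp: disjoint_family_on_def)
    then show "{\<gamma>. apply_bcontfun (T (e \<xi>)) \<gamma> \<noteq> 0} \<inter> {\<gamma>. apply_bcontfun (T (e \<eta>)) \<gamma> \<noteq> 0} = {}"
      by (auto simp: supp_def e_def T.scaleR)
  qed
  have key: "norm (\<Sum>i\<in>A. c i *\<^sub>R e i) \<le> b / a * norm (\<Sum>i\<in>B. d i *\<^sub>R e i)"
    if "finite B" "A \<subseteq> B" "B \<subseteq> Field omega1" "\<And>i. i \<in> B \<Longrightarrow> \<bar>c i\<bar> \<le> \<bar>d i\<bar>" for A B c d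
  proof -
    have "a * norm (\<Sum>i\<in>A. c i *\<^sub>R e i) \<le> norm (\<Sum>i\<in>A. c i *\<^sub>R T (e i))"
      using low[of "\<Sum>i\<in>A. c i *\<^sub>R e i"] by (simp add: T.sum T.scaleR)
    also have "\<dots> \<le> norm (\<Sum>i\<in>B. d i *\<^sub>R T (e i))"
      using that disj by (intro norm_sum_disjoint_supports_le disjoint_family_on_mono[OF _ disj]) auto
    also have "\<dots> \<le> b * norm (\<Sum>i\<in>B. d i *\<^sub>R e i)"
      using up[of "\<Sum>i\<in>B. d i *\<^sub>R e i"] by (simp add: T.sum T.scaleR)
    finally show ?thesis using a by (simp add: field_simps)
  qed
  have "C_unconditional (b / a) (Field omega1) e"
    unfolding C_unconditional_def
  proof (intro conjI nrm allI impI)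
    fix A and c \<theta> :: "nat set \<Rightarrow> real"
    assume A: "finite A \<and> A \<subseteq> Field omega1 \<and> (\<forall>\<alpha>\<in>A. \<theta> \<alpha> \<in> {1, -1})"
    then show "norm (\<Sum>\<alpha>\<in>A. c \<alpha> *\<^sub>R e \<alpha>) \<le> b / a * norm (\<Sum>\<alpha>\<in>A. (\<theta> \<alpha> * c \<alpha>) *\<^sub>R e \<alpha>)"
      by (intro key) auto
  qed
  moreover have "suppression_unconditional (b / a) (Field omega1) e"
    unfolding suppression_unconditional_def using nrm key by blast
  ultimately show ?thesis using that by blast
qed

section \<open>Norming families versus embeddings\<close>

text \<open>The operator sends \<open>x\<close> to its values under the family, so it has norm at
  most \<open>1\<close>. For the lower bound, take \<open>h\<close> attaining the norm at
  \<open>x\<close>: the half-space of functionals with value at most \<open>norm (T x)\<close> at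
  \<open>x\<close> contains the family, hence also \<open>C *\<^sub>R h\<close>.\<close>

lemma norming_family_imp_isomorphic:
  fixes f :: "'k \<Rightarrow> ('a::real_normed_vector \<Rightarrow>\<^sub>L real)"
  assumes C: "C > 0" and f: "\<And>\<alpha>. \<alpha> \<in> Field \<kappa> \<Longrightarrow> norm (f \<alpha>) = 1"
    and hull: "(\<lambda>h. C *\<^sub>R h) ` cball 0 1 \<subseteq> weak_star closure_of (convex hull (f ` Field \<kappa>))"
    and cnt: "\<And>x. countable {\<alpha> \<in> Field \<kappa>. blinfun_apply (f \<alpha>) x \<noteq> 0}"
  shows "isomorphic_to_subspace_of TYPE('a) (linf_omega \<kappa>)"
proof -
  define g where "g = (\<lambda>x \<gamma>. if of_discrete \<gamma> \<in> Field \<kappa> then blinfun_apply (f (of_discrete \<gamma>)) x else 0)"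
  have gle: "norm (g x \<gamma>) \<le> norm x" for x \<gamma>
    using norm_blinfun[of "f (of_discrete \<gamma>)" x] f[of "of_discrete \<gamma>"]
    by (cases "of_discrete \<gamma> \<in> Field \<kappa>") (auto simp: g_def)
  have gb: "g x \<in> bcontfun" for x
    using gle by (intro bcontfun_normI) (auto simp: continuous_on_open_vimage open_discrete)
  define T where "T = (\<lambda>x. Bcontfun (g x))"
  have T: "apply_bcontfun (T x) = g x" for x
    unfolding T_def by (rule Bcontfun_inverse[OF gb])
  have "bounded_linear T"
  proof (rule bounded_linear_intro)
    show "norm (T x) \<le> norm x * 1" for x
      using gle by (intro norm_bound) (simp add: T)
  qed (auto intro!: bcontfun_eqI simp: T g_def blinfun.add_right blinfun.scaleR_right)
  moreover have "range T \<subseteq> linf_omega \<kappa>"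
  proof
    fix u assume "u \<in> range T"
    then obtain x where u: "u = T x" by blast
    have "{\<alpha>. apply_bcontfun u (discrete \<alpha>) \<noteq> 0} = {\<alpha> \<in> Field \<kappa>. blinfun_apply (f \<alpha>) x \<noteq> 0}"
      by (auto simp: u T g_def discrete_inverse)
    then show "u \<in> linf_omega \<kappa>"
      using cnt[of x] by (simp add: linf_omega_def u T g_def discrete_inverse)
  qed
  moreover have "C * norm x \<le> norm (T x)" for x
  proof -
    obtain h where h: "norm h \<le> 1" "blinfun_apply h x = norm x"
      using norm_attaining_functional by blast
    have "f ` Field \<kappa> \<subseteq> {k. blinfun_apply k x \<le> norm (T x)}"
    proof (intro image_subsetI CollectI)
      fix \<alpha> assume "\<alpha> \<in> Field \<kappa>"
      then show "blinfun_apply (f \<alpha>) x \<le> norm (T x)"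
        using norm_bounded[of "T x" "discrete \<alpha>"] by (simp add: T g_def discrete_inverse)
    qed
    moreover have "convex {k :: 'a \<Rightarrow>\<^sub>L real. blinfun_apply k x \<le> norm (T x)}"
      by (auto simp: convex_def blinfun.add_left blinfun.scaleR_left intro: convex_bound_le)
    ultimately have hl: "convex hull (f ` Field \<kappa>) \<subseteq> {k. blinfun_apply k x \<le> norm (T x)}"
      by (rule hull_minimal)
    have "C *\<^sub>R h \<in> weak_star closure_of (convex hull (f ` Field \<kappa>))"
      using h(1) by (intro subsetD[OF hull] imageI) simp
    then have "blinfun_apply (C *\<^sub>R h) x \<le> norm (T x)"
      by (rule weak_star_closed_halfspace) (use hl in blast)
    then show ?thesis by (simp add: blinfun.scaleR_left h(2))
  qed
  ultimately show ?thesis using C by (intro isomorphic_to_subspace_ofI)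
qed

text \<open>Coordinate functionals may vanish, so the nonzero ones have to be reindexed by \<open>\<kappa>\<close>; there are
  \<open>\<kappa>\<close> many of them because countably many members of \<open>S\<close> are nonzero under each of them.\<close>

lemma linf_omega_embedding_imp_norming_family:
  fixes T :: "'a::real_normed_vector \<Rightarrow> ('k discrete \<Rightarrow>\<^sub>C real)"
  assumes \<kappa>: "Card_order \<kappa>" "natLeq <o \<kappa>"
    and wld: "WLD TYPE('a)" and dens: "has_density TYPE('a) \<kappa>"
    and T: "bounded_linear T" and ran: "range T \<subseteq> linf_omega \<kappa>"
    and a: "a > 0" and low: "\<And>x. a * norm x \<le> norm (T x)"
  shows "\<exists>C>0. \<exists>f :: 'k \<Rightarrow> ('a \<Rightarrow>\<^sub>L real).
           (\<forall>\<alpha>\<in>Field \<kappa>. f \<alpha> \<in> sphere 0 1) \<and>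
           (\<lambda>h. C *\<^sub>R h) ` cball 0 1 \<subseteq> weak_star closure_of (convex hull (f ` Field \<kappa>)) \<and>
           (\<forall>x. countable {\<alpha> \<in> Field \<kappa>. blinfun_apply (f \<alpha>) x \<noteq> 0})"
proof -
  interpret T: bounded_linear T by fact
  obtain b where b: "b > 0" "\<And>x. norm (T x) \<le> norm x * b"
    using T.pos_bounded by blast
  obtain S :: "'a set" where S: "0 \<notin> S" "closure (span S) = UNIV"
    and cS: "\<And>f :: 'a \<Rightarrow>\<^sub>L real. countable {s \<in> S. blinfun_apply f s \<noteq> 0}"
    using WLD_countable_supports[OF wld] by blast
  have Tle: "\<bar>apply_bcontfun (T x) \<gamma>\<bar> \<le> norm x * b" for x \<gamma>
    using norm_bounded[of "T x" \<gamma>] b(2)[of x] by simp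
  define F where "F = (\<lambda>\<gamma>. Blinfun (\<lambda>x. apply_bcontfun (T x) (discrete \<gamma>)))"
  have F: "blinfun_apply (F \<gamma>) x = apply_bcontfun (T x) (discrete \<gamma>)" for \<gamma> x
  proof -
    have "bounded_linear (\<lambda>x. apply_bcontfun (T x) (discrete \<gamma>))"
      using Tle by (intro bounded_linear_intro) (auto simp: T.add T.scaleR)
    then show ?thesis unfolding F_def by (simp add: bounded_linear_Blinfun_apply)
  qed
  have Fb: "norm (F \<gamma>) \<le> b" for \<gamma>
    using b(1) Tle by (intro norm_blinfun_bound) (auto simp: F mult.commute)
  have Fcnt: "countable {\<gamma>. blinfun_apply (F \<gamma>) x \<noteq> 0}" for x
    using ran by (auto simp: F linf_omega_def)
  define N where "N = {\<gamma>. F \<gamma> \<noteq> 0}"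
  have NF: "N \<subseteq> Field \<kappa>"
  proof
    fix \<gamma> assume "\<gamma> \<in> N"
    then obtain x where "apply_bcontfun (T x) (discrete \<gamma>) \<noteq> 0"
      unfolding N_def F[symmetric] by (metis blinfun_eqI mem_Collect_eq zero_blinfun.rep_eq)
    then show "\<gamma> \<in> Field \<kappa>" using ran by (auto simp: linf_omega_def)
  qed
  \<comment> \<open>\<open>T\<close> is bounded below, so every nonzero vector has a nonzero
    coordinate.\<close>
  have S_cover: "S \<subseteq> (\<Union>\<gamma>\<in>N. {s \<in> S. blinfun_apply (F \<gamma>) s \<noteq> 0})"
  proof
    fix s assume s: "s \<in> S"
    then have "s \<noteq> 0" using S(1) by auto
    then have "0 < norm (T s)" using low[of s] a by (smt (verit) mult_pos_pos zero_less_norm_iff)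
    then have "T s \<noteq> 0" by auto
    then obtain \<gamma> where "apply_bcontfun (T s) \<gamma> \<noteq> 0"
      by (metis bcontfun_eqI zero_bcontfun.rep_eq)
    then have "blinfun_apply (F (of_discrete \<gamma>)) s \<noteq> 0" by (simp add: F of_discrete_inverse)
    then show "s \<in> (\<Union>\<gamma>\<in>N. {s \<in> S. blinfun_apply (F \<gamma>) s \<noteq> 0})"
      using s by (force simp: N_def)
  qed
  have Nunc: "\<not> countable N"
  proof
    assume "countable N"
    then have "countable (\<Union>\<gamma>\<in>N. {s \<in> S. blinfun_apply (F \<gamma>) s \<noteq> 0})"
      using cS by (intro countable_UN) auto
    then show False
      using S_cover density_le_card_generators(2)[OF dens \<kappa>(2) S(2)] countable_subset by blast
  qed
  then have Ninf: "infinite N" using countable_finite by blast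
  have "|\<Union>\<gamma>\<in>N. {s \<in> S. blinfun_apply (F \<gamma>) s \<noteq> 0}| \<le>o |N|"
  proof (intro card_of_UNION_ordLeq_infinite Ninf ballI)
    fix \<gamma>
    have "|{s \<in> S. blinfun_apply (F \<gamma>) s \<noteq> 0}| \<le>o |UNIV :: nat set|"
      using cS countable_card_of_nat by blast
    then show "|{s \<in> S. blinfun_apply (F \<gamma>) s \<noteq> 0}| \<le>o |N|"
      using Ninf infinite_iff_card_of_nat ordLeq_transitive by blast
  qed (simp add: card_of_mono1)
  then have "|S| \<le>o |N|"
    using S_cover card_of_mono1 ordLeq_transitive by blast
  then have "\<kappa> \<le>o |N|"
    using density_le_card_generators(1)[OF dens \<kappa>(2) S(2)] ordLeq_transitive by blast
  then have "|Field \<kappa>| \<le>o |N|"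
    using card_of_Field_ordIso[OF \<kappa>(1)] ordIso_ordLeq_trans by blast
  then have "|Field \<kappa>| =o |N|"
    using card_of_mono1[OF NF] by (simp add: ordIso_iff_ordLeq)
  \<comment> \<open>The closed hull is to contain a ball, so each functional is paired with its
    negative; doubling does not change an infinite cardinal, and \<open>Field \<kappa>\<close> still
    suffices as index set.\<close>
  moreover have "|{1, - 1 :: real}| \<le>o |UNIV :: nat set|"
    by (simp add: countable_card_of_nat[symmetric])
  then have "|{1, - 1 :: real}| \<le>o |N|"
    using Ninf infinite_iff_card_of_nat ordLeq_transitive by blast
  then have "|N| =o |N \<times> {1, - 1 :: real}|"
    using Ninf by (intro card_of_Times_infinite_simps) auto
  ultimately have "|Field \<kappa>| =o |N \<times> {1, - 1 :: real}|" by (rule ordIso_transitive)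
  then obtain \<phi> where \<phi>: "bij_betw \<phi> (Field \<kappa>) (N \<times> {1, - 1 :: real})"
    using card_of_ordIso by blast
  define G where "G = (\<lambda>(\<gamma>, \<epsilon> :: real). (\<epsilon> / norm (F \<gamma>)) *\<^sub>R F \<gamma>)"
  define f where "f = (\<lambda>\<alpha>. G (\<phi> \<alpha>))"
  have mem: "\<phi> \<alpha> \<in> N \<times> {1, - 1}" if "\<alpha> \<in> Field \<kappa>" for \<alpha>
    using \<phi> that by (auto simp: bij_betw_def)
  have nG: "norm (G p) = 1" if "p \<in> N \<times> {1, - 1}" for p
    using that by (auto simp: G_def N_def)
  then have nf: "norm (f \<alpha>) = 1" if "\<alpha> \<in> Field \<kappa>" for \<alpha>
    using mem that by (auto simp: f_def)
  have fim: "f ` Field \<kappa> = G ` (N \<times> {1, - 1})"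
    using \<phi> by (simp add: f_def bij_betw_def image_image[symmetric])
  have "countable {\<alpha> \<in> Field \<kappa>. blinfun_apply (f \<alpha>) x \<noteq> 0}" for x
  proof (rule countable_image_inj_on)
    have "\<phi> ` {\<alpha> \<in> Field \<kappa>. blinfun_apply (f \<alpha>) x \<noteq> 0}
        \<subseteq> {\<gamma>. blinfun_apply (F \<gamma>) x \<noteq> 0} \<times> {1, - 1}"
    proof (rule image_subsetI)
      fix \<alpha> assume \<alpha>: "\<alpha> \<in> {\<alpha> \<in> Field \<kappa>. blinfun_apply (f \<alpha>) x \<noteq> 0}"
      obtain \<gamma> \<epsilon> where p: "\<phi> \<alpha> = (\<gamma>, \<epsilon>)" by fastforce
      then show "\<phi> \<alpha> \<in> {\<gamma>. blinfun_apply (F \<gamma>) x \<noteq> 0} \<times> {1, - 1}"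
        using \<alpha> mem[of \<alpha>] by (auto simp: f_def G_def blinfun.scaleR_left)
    qed
    then show "countable (\<phi> ` {\<alpha> \<in> Field \<kappa>. blinfun_apply (f \<alpha>) x \<noteq> 0})"
      by (rule countable_subset) (simp add: Fcnt)
    show "inj_on \<phi> {\<alpha> \<in> Field \<kappa>. blinfun_apply (f \<alpha>) x \<noteq> 0}"
      using \<phi> by (auto simp: bij_betw_def intro: inj_on_subset)
  qed
  \<comment> \<open>If the family is at most \<open>B\<close> at \<open>x\<close>, undoing the
    normalization with \<open>norm (F \<gamma>) \<le> b\<close> gives
    \<open>norm (T x) \<le> b * B\<close>, hence \<open>a * norm x \<le> b * B\<close>. This is
    where the radius \<open>a / b\<close> comes from.\<close>
  moreover have "(a / b) *\<^sub>R h \<in> weak_star closure_of (convex hull (f ` Field \<kappa>))"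
    if h: "norm h \<le> 1" for h
  proof (rule weak_star_separation)
    have "bounded (f ` Field \<kappa>)" using nf by (auto simp: bounded_iff intro!: exI[of _ 1])
    then show "bounded (convex hull (f ` Field \<kappa>))" by (rule bounded_convex_hull)
    fix x B assume B: "\<And>k. k \<in> convex hull (f ` Field \<kappa>) \<Longrightarrow> blinfun_apply k x \<le> B"
    have FB: "\<bar>blinfun_apply (F \<gamma>) x\<bar> \<le> b * B" if "\<gamma> \<in> N" for \<gamma>
    proof -
      have pos: "norm (F \<gamma>) > 0" using that by (simp add: N_def)
      have "\<epsilon> * blinfun_apply (F \<gamma>) x \<le> norm (F \<gamma>) * B" if "\<epsilon> \<in> {1, - 1}" for \<epsilon>
      proof -
        have "blinfun_apply (G (\<gamma>, \<epsilon>)) x \<le> B"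
          using that \<open>\<gamma> \<in> N\<close> by (intro B hull_inc) (auto simp: fim)
        then show ?thesis using pos by (simp add: G_def blinfun.scaleR_left field_simps)
      qed
      from this[of 1] this[of "- 1"]
      have le: "\<bar>blinfun_apply (F \<gamma>) x\<bar> \<le> norm (F \<gamma>) * B" by simp
      then have "0 \<le> norm (F \<gamma>) * B" by linarith
      then have "B \<ge> 0" using pos by (simp add: zero_le_mult_iff)
      then show ?thesis using le mult_right_mono[OF Fb[of \<gamma>], of B] by simp
    qed
    \<comment> \<open>Coordinates outside \<open>N\<close> are zero and lie below
      \<open>b * B\<close> only if \<open>B\<close> is nonnegative; any member of \<open>N\<close>
      shows this, thanks to the two signs.\<close>
    have "B \<ge> 0"
    proof -
      obtain \<gamma> where "\<gamma> \<in> N" using infinite_imp_nonempty[OF Ninf] by blast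
      then show ?thesis using order_trans[OF abs_ge_zero FB[of \<gamma>]] b(1)
        by (simp add: zero_le_mult_iff)
    qed
    have "norm (T x) \<le> b * B"
    proof (rule norm_bound)
      fix \<gamma>
      show "norm (apply_bcontfun (T x) \<gamma>) \<le> b * B"
      proof (cases "of_discrete \<gamma> \<in> N")
        case True
        then show ?thesis using FB[OF True] by (simp add: F of_discrete_inverse)
      next
        case False
        then have "apply_bcontfun (T x) \<gamma> = 0"
          using F[of "of_discrete \<gamma>" x] by (simp add: N_def of_discrete_inverse)
        then show ?thesis using b(1) \<open>B \<ge> 0\<close> by simp
      qed
    qed
    then have "a / b * norm x \<le> B"
      using low[of x] b(1) by (simp add: field_simps)
    moreover have "blinfun_apply h x \<le> norm x"
      using norm_blinfun[of h x] mult_right_mono[OF h, of "norm x"] by simp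
    ultimately show "blinfun_apply ((a / b) *\<^sub>R h) x \<le> B"
      using a b(1) mult_left_mono[of "blinfun_apply h x" "norm x" "a / b"]
      by (simp add: blinfun.scaleR_left)
  qed (rule convex_convex_hull)
  ultimately show ?thesis
    using a b(1) nf by (intro exI[of _ "a / b"] conjI exI[of _ f]) auto
qed

theorem corollary4p7:
  fixes \<kappa> :: "'k rel"
  assumes "Card_order \<kappa>" and "natLeq <o \<kappa>" and "regularCard \<kappa>"
    and "cardSuc (ctwo ^c natLeq) \<le>o \<kappa>"
    and "WLD TYPE('a::banach)" and "has_density TYPE('a) \<kappa>"
  shows
    "(isomorphic_to_subspace_of TYPE('a) (linf_omega \<kappa>) \<longleftrightarrow>
        (\<exists>C>0. \<exists>f :: 'k \<Rightarrow> ('a \<Rightarrow>\<^sub>L real).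
           (\<forall>\<alpha>\<in>Field \<kappa>. f \<alpha> \<in> sphere 0 1) \<and>
           (\<lambda>h. C *\<^sub>R h) ` cball 0 1 \<subseteq> weak_star closure_of (convex hull (f ` Field \<kappa>)) \<and>
           (\<forall>x. countable {\<alpha> \<in> Field \<kappa>. blinfun_apply (f \<alpha>) x \<noteq> 0}))) \<and>
     (isomorphic_to_subspace_of TYPE('a) (linf_omega \<kappa>) \<longrightarrow>
        (\<exists>e :: nat set \<Rightarrow> 'a. unconditional_basic (Field omega1) e)) \<and>
     (embeds_isometrically_into TYPE('a) (linf_omega \<kappa>) \<longrightarrow>
        (\<exists>e :: nat set \<Rightarrow> 'a. unconditional_basic (Field omega1) e \<and>
           suppression_unconditional 1 (Field omega1) e))"
    (is "(?iso \<longleftrightarrow> ?norming) \<and> (?iso \<longrightarrow> ?unc) \<and> (?isometric \<longrightarrow> ?supp)")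
proof (intro conjI impI iffI)
  assume ?iso
  then obtain T :: "'a \<Rightarrow> 'k discrete \<Rightarrow>\<^sub>C real" and a where T: "bounded_linear T"
    "range T \<subseteq> linf_omega \<kappa>" "a > 0" "\<And>x. a * norm x \<le> norm (T x)"
    using isomorphic_to_subspace_ofD by blast
  show ?norming
    by (rule linf_omega_embedding_imp_norming_family[OF assms(1,2,5,6) T])
  obtain b where "\<And>x. norm (T x) \<le> b * norm x"
    using bounded_linear.bounded[OF T(1)] by (metis mult.commute)
  from linf_omega_embedding_unconditional[OF assms(5,6,2) T this]
  show ?unc unfolding unconditional_basic_def by blast
next
  assume ?norming
  then obtain C and f :: "'k \<Rightarrow> ('a \<Rightarrow>\<^sub>L real)" where f: "C > 0" "\<forall>\<alpha>\<in>Field \<kappa>. f \<alpha> \<in> sphere 0 1"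
    "(\<lambda>h. C *\<^sub>R h) ` cball 0 1 \<subseteq> weak_star closure_of (convex hull (f ` Field \<kappa>))"
    "\<forall>x. countable {\<alpha> \<in> Field \<kappa>. blinfun_apply (f \<alpha>) x \<noteq> 0}"
    by blast
  show ?iso
    using f(2,4) by (intro norming_family_imp_isomorphic[OF f(1) _ f(3)]) auto
next
  assume ?isometric
  then obtain T :: "'a \<Rightarrow> 'k discrete \<Rightarrow>\<^sub>C real" where T: "linear T"
    "range T \<subseteq> linf_omega \<kappa>" "\<And>x. norm (T x) = norm x"
    unfolding embeds_isometrically_into_def by blast
  have "bounded_linear T"
    using T by (intro bounded_linear_intro[where K = 1]) (auto simp: linear_add linear_scale)
  \<comment> \<open>An isometry has \<open>a = b = 1\<close>, so the constant is exactly
    \<open>1\<close>.\<close>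
  then obtain e :: "nat set \<Rightarrow> 'a" where "C_unconditional (1 / 1) (Field omega1) e"
    "suppression_unconditional (1 / 1) (Field omega1) e"
    using T by (rule_tac linf_omega_embedding_unconditional[OF assms(5,6,2), of T \<kappa> 1 1]) auto
  then show ?supp unfolding unconditional_basic_def by auto
qed

end
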